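(* Let $\mathcal{A}(2)=\{(1,0),(1,1),(2,3)\}\subset\mathbb{Z}^2$, $w=(1,1,1)$, and $\mathcal{A}(2)_w=\{(1,0,1),(1,1,1),(2,3,1),(0,0,1)\}\subset\mathbb{Z}^3$. Then the semigroup $\mathbb{N}\mathcal{A}(2)_w$ is saturated.
   Context: $\mathbb{N}$ contains $0$. For a finite set $\mathcal{B}\subset\mathbb{Z}^k$, $\mathbb{N}\mathcal{B}$ is the submonoid of $\mathbb{Z}^k$ generated by $\mathcal{B}$. The semigroup $S=\mathbb{N}\mathcal{B}$ is saturated if $S=\overline{S}$, where $\overline{S}:=\mathbb{R}_{\geq0}S\cap\mathbb{Z}^k$ and $\mathbb{R}_{\geq 0}S$ is the cone of nonnegative real linear combinations of elements of $S$. *)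

theory Defs
  imports "HOL-Analysis.Analysis"
begin

inductive_set nat_span :: "'a::comm_monoid_add set \<Rightarrow> 'a set" for B where
  zero: "0 \<in> nat_span B"
| gen: "b \<in> B \<Longrightarrow> b \<in> nat_span B"
| add: "\<lbrakk>x \<in> nat_span B; y \<in> nat_span B\<rbrakk> \<Longrightarrow> x + y \<in> nat_span B"

definition real_vec :: "int ^ 'k \<Rightarrow> real ^ 'k" where
  "real_vec x = (\<chi> i. real_of_int (x $ i))"

definition real_cone :: "'a::real_vector set \<Rightarrow> 'a set" where
  "real_cone X = {\<Sum>x\<in>T. c x *\<^sub>R x | T c. finite T \<and> T \<subseteq> X \<and> (\<forall>x\<in>T. 0 \<le> c x)}"

lemma real_cone_eq_hull: "real_cone X = convex_cone hull X"
proof (rule hull_unique[symmetric])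
  show "X \<subseteq> real_cone X"
  proof
    fix x assume "x \<in> X"
    then show "x \<in> real_cone X"
      unfolding real_cone_def
      by (intro CollectI exI[of _ "{x}"] exI[of _ "\<lambda>_. 1"]) auto
  qed
  show "convex_cone (real_cone X)"
    unfolding convex_cone_iff
  proof (intro conjI ballI allI impI)
    show "0 \<in> real_cone X"
      unfolding real_cone_def by (intro CollectI exI[of _ "{}"]) auto
  next
    fix x y assume "x \<in> real_cone X" "y \<in> real_cone X"
    then obtain T c U d where
      T: "finite T" "T \<subseteq> X" "\<forall>t\<in>T. 0 \<le> c t" "x = (\<Sum>t\<in>T. c t *\<^sub>R t)" and
      U: "finite U" "U \<subseteq> X" "\<forall>t\<in>U. 0 \<le> d t" "y = (\<Sum>t\<in>U. d t *\<^sub>R t)"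
      unfolding real_cone_def by blast
    define e where "e t = (if t \<in> T then c t else 0) + (if t \<in> U then d t else 0)" for t
    have "x = (\<Sum>t\<in>T \<union> U. (if t \<in> T then c t else 0) *\<^sub>R t)"
      unfolding T(4) using T(1) U(1) by (intro sum.mono_neutral_cong_left) auto
    moreover have "y = (\<Sum>t\<in>T \<union> U. (if t \<in> U then d t else 0) *\<^sub>R t)"
      unfolding U(4) using T(1) U(1) by (intro sum.mono_neutral_cong_left) auto
    ultimately have "x + y = (\<Sum>t\<in>T \<union> U. e t *\<^sub>R t)"
      by (simp only: e_def scaleR_add_left sum.distrib)
    moreover have "finite (T \<union> U)" "T \<union> U \<subseteq> X" "\<forall>t\<in>T \<union> U. 0 \<le> e t"
      using T U by (auto simp: e_def)
    ultimately show "x + y \<in> real_cone X"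
      unfolding real_cone_def by blast
  next
    fix x and r :: real assume "x \<in> real_cone X" "0 \<le> r"
    then obtain T c where
      T: "finite T" "T \<subseteq> X" "\<forall>t\<in>T. 0 \<le> c t" "x = (\<Sum>t\<in>T. c t *\<^sub>R t)"
      unfolding real_cone_def by blast
    have "r *\<^sub>R x = (\<Sum>t\<in>T. (r * c t) *\<^sub>R t)"
      by (simp add: T(4) scaleR_right.sum)
    moreover have "\<forall>t\<in>T. 0 \<le> r * c t" using T(3) \<open>0 \<le> r\<close> by simp
    ultimately show "r *\<^sub>R x \<in> real_cone X"
      using T(1,2) unfolding real_cone_def
      by (intro CollectI exI[of _ T] exI[of _ "\<lambda>t. r * c t"]) simp
  qed
next
  fix C assume C: "X \<subseteq> C" "convex_cone C"
  show "real_cone X \<subseteq> C"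
  proof
    fix x assume "x \<in> real_cone X"
    then obtain T c where
      T: "finite T" "T \<subseteq> X" "\<forall>t\<in>T. 0 \<le> c t" "x = (\<Sum>t\<in>T. c t *\<^sub>R t)"
      unfolding real_cone_def by blast
    have "(\<Sum>t\<in>T. c t *\<^sub>R t) \<in> C"
      using T(1-3)
    proof (induction T rule: finite_induct)
      case empty
      show ?case using C(2) by (simp add: convex_cone_contains_0)
    next
      case (insert t T)
      then show ?case
        using C by (auto intro!: convex_cone_add convex_cone_scaleR)
    qed
    then show "x \<in> C" by (simp add: T(4))
  qed
qed

definition saturation :: "(int ^ 'k) set \<Rightarrow> (int ^ 'k) set" where
  "saturation S = {z. real_vec z \<in> real_cone (real_vec ` S)}"

definition saturated :: "(int ^ 'k) set \<Rightarrow> bool" where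
  "saturated S \<longleftrightarrow> S = saturation S"

text \<open>The generators are listed in order, since the weight vector is indexed by that order.\<close>

definition A2 :: "(int ^ 2) list" where
  "A2 = [vector [1, 0], vector [1, 1], vector [2, 3]]"

definition w :: "int list" where
  "w = [1, 1, 1]"

definition A2w :: "(int ^ 3) set" where
  "A2w = {vector [1, 0, 1], vector [1, 1, 1], vector [2, 3, 1], vector [0, 0, 1]}"

lemma A2w_eq_lift:
  "A2w = (\<lambda>(a, c). vector [a $ 1, a $ 2, c]) ` set (zip A2 w) \<union> {vector [0, 0, 1]}"
  by (auto simp: A2w_def A2_def w_def)

end

theory Submission
  imports Defs
begin

text \<open>
  At height 1 the generators are the lattice points of the triangle with vertices (0,0), (1,0),
  (2,3): the vertices and the interior point (1,1). Joining (1,1) to the vertices cuts the triangle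
  into three unimodular ones, so a lattice point of the cone is a combination, with natural
  coefficients, of the generators spanning the subcone that contains it.
\<close>

lemma subset_saturation: "S \<subseteq> saturation S"
  by (auto simp: saturation_def real_cone_eq_hull intro: hull_inc)

text \<open>The product on \<open>int ^ 'k\<close> is componentwise and \<open>of_nat n\<close> is
  the constant vector, so this product is the n-fold sum of \<open>b\<close>.\<close>

lemma nat_span_of_nat_mult:
  fixes b :: "int ^ 'k"
  assumes "b \<in> B"
  shows "of_nat n * b \<in> nat_span B"
proof (induction n)
  case 0
  show ?case by (simp add: nat_span.zero)
next
  case (Suc n)
  then show ?case using assms by (simp add: distrib_right nat_span.gen nat_span.add)
qed

lemma nat_span_A2wI:
  assumes "0 \<le> a" "0 \<le> b" "0 \<le> c" "0 \<le> d"
    and "z $ 1 = a + b + 2 * c" "z $ 2 = b + 3 * c" "z $ 3 = a + b + c + d"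
  shows "z \<in> nat_span A2w"
proof -
  have "of_nat (nat a) * vector [1, 0, 1] + of_nat (nat b) * vector [1, 1, 1]
      + of_nat (nat c) * vector [2, 3, 1] + of_nat (nat d) * vector [0, 0, 1] \<in> nat_span A2w"
    by (intro nat_span.add nat_span_of_nat_mult) (auto simp: A2w_def)
  also have "of_nat (nat a) * vector [1, 0, 1] + of_nat (nat b) * vector [1, 1, 1]
      + of_nat (nat c) * vector [2, 3, 1] + of_nat (nat d) * vector [0, 0, 1] = z"
    using assms by (simp add: vec_eq_iff forall_3 of_nat_index del: of_nat_nat)
  finally show ?thesis .
qed

text \<open>One inequality for each edge of the triangle: these are the facets of the cone. Each
  holds at the four generators and survives addition.\<close>

lemma nat_span_A2w_ge:
  assumes "z \<in> nat_span A2w"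
  shows "0 \<le> z $ 2 \<and> 2 * z $ 2 \<le> 3 * z $ 1 \<and> 3 * z $ 1 \<le> z $ 2 + 3 * z $ 3"
  using assms by (induction rule: nat_span.induct) (auto simp: A2w_def)

text \<open>The same inequalities over the reals cut out a convex cone, which therefore contains the
  hull of the semigroup.\<close>

lemma saturation_nat_span_A2w_ge:
  assumes "z \<in> saturation (nat_span A2w)"
  shows "0 \<le> z $ 2 \<and> 2 * z $ 2 \<le> 3 * z $ 1 \<and> 3 * z $ 1 \<le> z $ 2 + 3 * z $ 3"
proof -
  define C :: "(real ^ 3) set"
    where "C = {v. 0 \<le> v $ 2 \<and> 2 * v $ 2 \<le> 3 * v $ 1 \<and> 3 * v $ 1 \<le> v $ 2 + 3 * v $ 3}"
  have "r *\<^sub>R v \<in> C" if "v \<in> C" "0 \<le> r" for r v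
    using that mult_left_mono[of "2 * v $ 2" "3 * v $ 1" r]
      mult_left_mono[of "3 * v $ 1" "v $ 2 + 3 * v $ 3" r]
    by (simp add: C_def algebra_simps)
  then have "convex_cone C"
    by (auto simp: convex_cone_iff C_def)
  moreover have "real_vec ` nat_span A2w \<subseteq> C"
    by (auto simp: C_def real_vec_def dest!: nat_span_A2w_ge)
  ultimately have "real_vec z \<in> C"
    using assms hull_minimal[of _ C convex_cone]
    by (auto simp: saturation_def real_cone_eq_hull)
  then show ?thesis
    unfolding C_def real_vec_def by simp
qed

theorem proposition3p2:
  shows "saturated (nat_span A2w)"
proof -
  have "z \<in> nat_span A2w" if z: "z \<in> saturation (nat_span A2w)" for z
  proof -
    let ?x = "z $ 1" and ?y = "z $ 2" and ?h = "z $ 3"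
    have ge: "0 \<le> ?y" "2 * ?y \<le> 3 * ?x" "3 * ?x \<le> ?y + 3 * ?h"
      using saturation_nat_span_A2w_ge[OF z] by auto
    \<comment> \<open>The walls are the planes through (1,1,1) and one vertex generator. The cases
      say which of 0, \<open>?y - ?x\<close>, \<open>?x - ?h\<close> is largest.\<close>
    consider "?y \<le> ?x" "?x \<le> ?h" | "?x \<le> ?y" "2 * ?x \<le> ?y + ?h"
      | "?h \<le> ?x" "?y + ?h \<le> 2 * ?x"
      by linarith
    then show ?thesis
    proof cases
      case 1
      \<comment> \<open>The witnesses solve the coordinate equations with coefficient 0 at the
        vertex outside the subcone, here (2,3,1). The coefficient of (1,1,1) is nonnegative by a
        facet inequality, the other two by the walls.\<close>
      then show ?thesis
        using ge by (intro nat_span_A2wI[of "?x - ?y" ?y 0 "?h - ?x"]) auto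
    next
      case 2
      then show ?thesis
        using ge by (intro nat_span_A2wI[of 0 "3 * ?x - 2 * ?y" "?y - ?x" "?y + ?h - 2 * ?x"]) auto
    next
      case 3
      then show ?thesis
        using ge by (intro nat_span_A2wI[of "2 * ?x - ?y - ?h" "?y + 3 * ?h - 3 * ?x" "?x - ?h" 0]) auto
    qed
  qed
  then show ?thesis
    using subset_saturation[of "nat_span A2w"] by (auto simp: saturated_def)
qed

end
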